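(* For any integer $k\ge 2$ and any fixed graph $G$ with $\chi(G)\ge k+1$, $$\hat{\pi}_k(G)=1-\frac{1}{\chi(G)-1}.$$
   Context: A $k$-graph is a hypergraph all of whose edges have exactly $k$ vertices. The shadow $\partial(\mathcal{H})$ of a hypergraph $\mathcal{H}$ is the simple graph on $V(\mathcal{H})$ in which $uv$ is an edge iff $\{u,v\}\subseteq h$ for some edge $h$ of $\mathcal{H}$. For a simple graph $G$, a hypergraph $\mathcal{H}$ is a Berge-$G$ if there is an injection $i:V(G)\to V(\mathcal{H})$ and a bijection $f:E(G)\to E(\mathcal{H})$ with $\{i(u),i(v)\}\subseteq f(uv)$ for every $uv\in E(G)$; $\mathcal{H}$ is Berge-$G$-free if no subhypergraph of it is a Berge-$G$. $\hat{\mathrm{ex}}_k(n,G)$ is the maximum number of edges of $\partial(\mathcal{H})$ over all Berge-$G$-free $k$-graphs $\mathcal{H}$ on $n$ vertices, and the cover Turán density is $\hat{\pi}_k(G)=\limsup_{n\to\infty}\hat{\mathrm{ex}}_k(n,G)/\binom{n}{2}$. $\chi(G)$ is the chromatic number. *)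

theory Defs
  imports "HOL-Analysis.Analysis"
begin

type_synonym 'a hgraph = "'a set \<times> 'a set set"

abbreviation verts :: "'a hgraph \<Rightarrow> 'a set" where
  "verts H \<equiv> fst H"

abbreviation edges :: "'a hgraph \<Rightarrow> 'a set set" where
  "edges H \<equiv> snd H"

definition hypergraph :: "'a hgraph \<Rightarrow> bool" where
  "hypergraph H \<longleftrightarrow> finite (verts H) \<and> (\<forall>h\<in>edges H. h \<subseteq> verts H)"

definition k_graph :: "nat \<Rightarrow> 'a hgraph \<Rightarrow> bool" where
  "k_graph k H \<longleftrightarrow> hypergraph H \<and> (\<forall>h\<in>edges H. card h = k)"

abbreviation simple_graph :: "'a hgraph \<Rightarrow> bool" where
  "simple_graph G \<equiv> k_graph 2 G"

definition shadow :: "'a hgraph \<Rightarrow> 'a hgraph" where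
  "shadow H = (verts H, {{u, v} | u v. u \<noteq> v \<and> (\<exists>h\<in>edges H. {u, v} \<subseteq> h)})"

definition subhypergraph :: "'a hgraph \<Rightarrow> 'a hgraph \<Rightarrow> bool" where
  "subhypergraph H' H \<longleftrightarrow>
     hypergraph H' \<and> verts H' \<subseteq> verts H \<and> edges H' \<subseteq> edges H"

definition is_Berge :: "'a hgraph \<Rightarrow> 'b hgraph \<Rightarrow> bool" where
  "is_Berge G H \<longleftrightarrow>
     (\<exists>i f. inj_on i (verts G) \<and> i ` verts G \<subseteq> verts H \<and>
            bij_betw f (edges G) (edges H) \<and>
            (\<forall>u v. {u, v} \<in> edges G \<longrightarrow> {i u, i v} \<subseteq> f {u, v}))"

definition Berge_free :: "'a hgraph \<Rightarrow> 'b hgraph \<Rightarrow> bool" where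
  "Berge_free G H \<longleftrightarrow> \<not> (\<exists>H'. subhypergraph H' H \<and> is_Berge G H')"

text \<open>Every finite hypergraph is isomorphic to one whose vertices are natural numbers,
  so the maximum is taken over hypergraphs on vertex type \<^typ>\<open>nat\<close>.  The set below is
  always finite; it is nonempty whenever \<open>G\<close> has an edge.\<close>

definition cover_ex :: "nat \<Rightarrow> nat \<Rightarrow> 'a hgraph \<Rightarrow> nat" where
  "cover_ex k n G =
     Max {card (edges (shadow H)) | H :: nat hgraph.
            k_graph k H \<and> card (verts H) = n \<and> Berge_free G H}"

text \<open>The limit superior is taken in \<^typ>\<open>ereal\<close>, since the real numbers are not a
  complete lattice.\<close>

definition cover_turan_density :: "nat \<Rightarrow> 'a hgraph \<Rightarrow> ereal" where
  "cover_turan_density k G =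
     limsup (\<lambda>n. ereal (real (cover_ex k n G) / real (n choose 2)))"

definition proper_coloring :: "'a hgraph \<Rightarrow> nat \<Rightarrow> ('a \<Rightarrow> nat) \<Rightarrow> bool" where
  "proper_coloring G c col \<longleftrightarrow>
     col ` verts G \<subseteq> {..<c} \<and> (\<forall>u v. {u, v} \<in> edges G \<longrightarrow> col u \<noteq> col v)"

definition chromatic_number :: "'a hgraph \<Rightarrow> nat" where
  "chromatic_number G = (LEAST c. \<exists>col. proper_coloring G c col)"

end

theory Submission
  imports Defs
begin

text \<open>
  Let \<open>r = \<chi>(G) - 1\<close>. For the lower bound, split the vertices into \<open>r\<close> balanced classes and take all
  \<open>k\<close>-sets meeting each class at most once. As \<open>r \<ge> k\<close>, the shadow is complete \<open>r\<close>-partite, and a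
  Berge copy of \<open>G\<close> would give an \<open>r\<close>-colouring of \<open>G\<close>.

  For the upper bound, let the shadow have density at least \<open>1 - 1/r + 2\<epsilon>\<close>. A set \<open>S\<close> maximising
  \<open>2 e(S) - (1 - 1/r + \<epsilon>) |S|\<^sup>2\<close> is large and has high minimum degree, so choosing vertices one by one
  gives a positive proportion of homomorphisms of the complete graph on \<open>r + 1\<close> vertices into \<open>S\<close>.
  Duplicating a vertex at worst squares the homomorphism density, by Cauchy-Schwarz, hence at least \<open>\<delta> |S|\<^sup>m\<close> maps
  \<open>V(G) \<rightarrow> S\<close> are homomorphisms, where \<open>m = |V(G)|\<close>. Fix a hyperedge covering each shadow edge. Only
  \<open>O(|S| ^ (m - 1))\<close> maps are non-injective or send a vertex into the hyperedge assigned to an edge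
  not containing it, and any other homomorphism yields a Berge copy of \<open>G\<close>.
\<close>

section \<open>Counting homomorphisms of complete multipartite graphs\<close>

text \<open>These are the homomorphisms from the complete multipartite graph on \<open>V\<close>
  whose parts are the fibres of \<open>col\<close>. If \<open>col\<close> properly colours a graph
  on \<open>V\<close>, each of them is also a homomorphism of that graph, and equally coloured
  vertices are twins.\<close>

definition multipartite_homs ::
  "('b \<Rightarrow> 'b \<Rightarrow> bool) \<Rightarrow> ('v \<Rightarrow> 'c) \<Rightarrow> 'v set \<Rightarrow> 'b set \<Rightarrow> ('v \<Rightarrow> 'b) set" where
  "multipartite_homs A col V S =
     {\<phi> \<in> V \<rightarrow>\<^sub>E S. \<forall>u\<in>V. \<forall>v\<in>V. col u \<noteq> col v \<longrightarrow> A (\<phi> u) (\<phi> v)}"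

definition extensions ::
  "('b \<Rightarrow> 'b \<Rightarrow> bool) \<Rightarrow> ('v \<Rightarrow> 'c) \<Rightarrow> 'v set \<Rightarrow> 'b set \<Rightarrow> 'v \<Rightarrow> ('v \<Rightarrow> 'b) \<Rightarrow> 'b set" where
  "extensions A col V S b \<psi> = {x \<in> S. \<forall>u\<in>V. col u \<noteq> col b \<longrightarrow> A (\<psi> u) x}"

lemma finite_multipartite_homs:
  assumes "finite V" "finite S"
  shows "finite (multipartite_homs A col V S)"
  unfolding multipartite_homs_def
  by (rule finite_subset[OF _ finite_PiE[OF assms(1), of "\<lambda>_. S"]]) (use assms in auto)

lemma finite_extensions: "finite S \<Longrightarrow> finite (extensions A col V S b \<psi>)"
  unfolding extensions_def by simp

text \<open>The inverse sends \<open>\<phi>\<close> to its restriction to \<open>V\<close> together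
  with the value at \<open>b\<close>. Since maps in \<open>V \<rightarrow>\<^sub>E S\<close> are
  \<open>undefined\<close> at \<open>b\<close>, overwriting that value loses nothing.\<close>

lemma multipartite_homs_insert:
  assumes "symp A" "b \<notin> V"
  shows "bij_betw (\<lambda>(\<psi>, x). \<psi>(b := x))
    (SIGMA \<psi> : multipartite_homs A col V S. extensions A col V S b \<psi>)
    (multipartite_homs A col (insert b V) S)"
  (is "bij_betw ?f ?D ?R")
proof -
  have inj: "inj_on ?f ?D"
  proof (rule inj_onI)
    fix p q assume p: "p \<in> ?D" and q: "q \<in> ?D" and eq: "?f p = ?f q"
    obtain \<psi> x \<psi>' x' where pq: "p = (\<psi>, x)" "q = (\<psi>', x')" by force
    have "\<psi> \<in> V \<rightarrow>\<^sub>E S" "\<psi>' \<in> V \<rightarrow>\<^sub>E S"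
      using p q pq by (auto simp: multipartite_homs_def)
    then have "\<psi> b = undefined" "\<psi>' b = undefined"
      using \<open>b \<notin> V\<close> by (auto simp: PiE_def extensional_def)
    moreover have "\<psi>(b := x) = \<psi>'(b := x')" using eq pq by simp
    ultimately have "x = x' \<and> \<psi> = \<psi>'"
      by (metis fun_upd_same fun_upd_triv fun_upd_upd)
    then show "p = q" using pq by simp
  qed
  have "?f ` ?D \<subseteq> ?R"
  proof (clarsimp)
    fix \<psi> x
    assume \<psi>: "\<psi> \<in> multipartite_homs A col V S" and x: "x \<in> extensions A col V S b \<psi>"
    have "\<psi>(b := x) \<in> insert b V \<rightarrow>\<^sub>E S"
      using \<psi> x by (intro PiE_fun_upd) (auto simp: multipartite_homs_def extensions_def)
    then show "\<psi>(b := x) \<in> ?R"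
      using \<psi> x assms by (auto simp: multipartite_homs_def extensions_def dest: sympD)
  qed
  moreover have "?R \<subseteq> ?f ` ?D"
  proof
    fix \<phi> assume \<phi>: "\<phi> \<in> ?R"
    let ?\<psi> = "restrict \<phi> V"
    have P: "\<phi> \<in> insert b V \<rightarrow>\<^sub>E S" using \<phi> by (simp add: multipartite_homs_def)
    have "?\<psi> \<in> multipartite_homs A col V S"
      using \<phi> P by (auto simp: multipartite_homs_def)
    moreover have "\<phi> b \<in> extensions A col V S b ?\<psi>"
      using \<phi> P by (auto simp: multipartite_homs_def extensions_def)
    moreover have "\<phi> = ?\<psi>(b := \<phi> b)"
      using P by (auto simp: fun_eq_iff PiE_def extensional_def)
    ultimately show "\<phi> \<in> ?f ` ?D" by (intro image_eqI[of _ _ "(?\<psi>, \<phi> b)"]) auto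
  qed
  ultimately show ?thesis using inj by (auto simp: bij_betw_def)
qed

lemma card_multipartite_homs_insert:
  assumes "symp A" "b \<notin> V" "finite V" "finite S"
  shows "card (multipartite_homs A col (insert b V) S)
    = (\<Sum>\<psi>\<in>multipartite_homs A col V S. card (extensions A col V S b \<psi>))"
  unfolding bij_betw_same_card[OF multipartite_homs_insert[OF assms(1,2)], symmetric]
  by (rule card_SigmaI) (use assms in \<open>auto intro: finite_multipartite_homs finite_extensions\<close>)

text \<open>Delete \<open>a\<close> and let \<open>\<psi>\<close> range over the homomorphisms
  \<open>P\<close> of the rest. If \<open>a\<close> has \<open>h \<psi>\<close> admissible images,
  then \<open>\<psi>\<close> has \<open>h \<psi>\<close> extensions to \<open>a\<close>, and its
  square many to the twins \<open>a\<close> and \<open>b\<close>, chosen independently.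
  Cauchy-Schwarz over \<open>P\<close> compares the two sums.\<close>

lemma card_multipartite_homs_twin:
  assumes "symp A" "b \<notin> V" "a \<in> V" "col a = col b" "finite V" "finite S"
  shows "(card (multipartite_homs A col V S))\<^sup>2
    \<le> card S ^ (card V - 1) * card (multipartite_homs A col (insert b V) S)"
proof -
  define W where "W = V - {a}"
  have V: "V = insert a W" "a \<notin> W" "finite W" using assms W_def by auto
  define P where "P = multipartite_homs A col W S"
  define h where "h \<psi> = card (extensions A col W S a \<psi>)" for \<psi>
  have finP: "finite P" unfolding P_def by (rule finite_multipartite_homs) (use V assms in auto)
  have cV: "card (multipartite_homs A col V S) = sum h P"
    unfolding V(1) P_def h_def by (rule card_multipartite_homs_insert) (use V assms in auto)
  \<comment> \<open>Equal colours impose no condition between \<open>a\<close> and \<open>b\<close>,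
    so the image of \<open>a\<close> does not affect the choices for \<open>b\<close>.\<close>
  have ext: "extensions A col V S b (\<psi>(a := x)) = extensions A col W S a \<psi>" for \<psi> x
    using V assms(4) by (auto simp: extensions_def)
  have "card (multipartite_homs A col (insert b V) S)
      = (\<Sum>\<phi>\<in>multipartite_homs A col V S. card (extensions A col V S b \<phi>))"
    by (rule card_multipartite_homs_insert) (use assms in auto)
  also have "\<dots> = (\<Sum>(\<psi>, x)\<in>(SIGMA \<psi> : P. extensions A col W S a \<psi>).
      card (extensions A col V S b (\<psi>(a := x))))"
    using sum.reindex_bij_betw[OF multipartite_homs_insert[OF assms(1) V(2), of col S],
        of "\<lambda>\<phi>. card (extensions A col V S b \<phi>)"]
    unfolding V(1) P_def by (simp add: case_prod_unfold)
  also have "\<dots> = (\<Sum>\<psi>\<in>P. \<Sum>x\<in>extensions A col W S a \<psi>. h \<psi>)"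
    by (subst sum.Sigma) (use finP finite_extensions[OF assms(6)] in \<open>auto simp: ext h_def\<close>)
  also have "\<dots> = (\<Sum>\<psi>\<in>P. (h \<psi>)\<^sup>2)"
    by (simp add: h_def power2_eq_square)
  finally have cbV: "card (multipartite_homs A col (insert b V) S) = (\<Sum>\<psi>\<in>P. (h \<psi>)\<^sup>2)" .
  have "card P \<le> card (W \<rightarrow>\<^sub>E S)"
    unfolding P_def multipartite_homs_def
    by (rule card_mono) (use V assms in \<open>auto intro: finite_PiE\<close>)
  then have cP: "card P \<le> card S ^ (card V - 1)"
    using V by (simp add: card_PiE)
  have "(real (sum h P))\<^sup>2 \<le> real (card P) * (\<Sum>\<psi>\<in>P. (real (h \<psi>))\<^sup>2)"
    using Cauchy_Schwarz_ineq_sum[of "\<lambda>_. 1" "\<lambda>\<psi>. real (h \<psi>)" P] by simp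
  then have "real ((sum h P)\<^sup>2) \<le> real (card P * (\<Sum>\<psi>\<in>P. (h \<psi>)\<^sup>2))" by simp
  then have "(sum h P)\<^sup>2 \<le> card P * (\<Sum>\<psi>\<in>P. (h \<psi>)\<^sup>2)" by (simp only: of_nat_le_iff)
  also have "\<dots> \<le> card S ^ (card V - 1) * (\<Sum>\<psi>\<in>P. (h \<psi>)\<^sup>2)"
    using cP by (rule mult_right_mono) simp
  finally show ?thesis by (simp only: cV cbV)
qed

text \<open>Vertices are embedded one at a time. Each of the at most \<open>r\<close> earlier images
  excludes at most \<open>card S - d\<close> non-neighbours, which leaves at least
  \<open>\<beta> * card S\<close> choices.\<close>

lemma card_multipartite_homs_min_degree:
  assumes "symp A" "finite S" "finite T" "card T \<le> Suc r" "\<beta> \<ge> 0"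
    and deg: "\<And>x. x \<in> S \<Longrightarrow> real (card {y \<in> S. A x y}) \<ge> d"
    and d: "real (card S) - real r * (real (card S) - d) \<ge> \<beta> * real (card S)" "d \<le> real (card S)"
  shows "real (card (multipartite_homs A col T S)) \<ge> (\<beta> * real (card S)) ^ card T"
  using assms(3,4)
proof (induction T rule: finite_induct)
  case empty
  have "multipartite_homs A col {} S = {\<lambda>_. undefined}" by (auto simp: multipartite_homs_def)
  then show ?case by simp
next
  case (insert b T)
  have ext: "real (card (extensions A col T S b \<psi>)) \<ge> \<beta> * real (card S)"
    if "\<psi> \<in> multipartite_homs A col T S" for \<psi>
  proof -
    have \<psi>S: "\<psi> u \<in> S" if "u \<in> T" for u
      using \<open>\<psi> \<in> _\<close> that by (auto simp: multipartite_homs_def)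
    define N where "N u = {x \<in> S. \<not> A (\<psi> u) x}" for u
    have cN: "real (card (N u)) \<le> real (card S) - d" if "u \<in> T" for u
    proof -
      have "card (N u) + card {y \<in> S. A (\<psi> u) y} = card S"
        unfolding N_def using assms(2)
        by (subst card_Un_disjoint[symmetric]) (auto intro: arg_cong[of _ _ card])
      then show ?thesis using deg[OF \<psi>S[OF that]] by linarith
    qed
    have "real (card (\<Union>u\<in>T. N u)) \<le> (\<Sum>u\<in>T. real (card (N u)))"
      using card_UN_le[OF insert.hyps(1), of N] by (metis of_nat_le_iff of_nat_sum)
    also have "\<dots> \<le> (\<Sum>u\<in>T. real (card S) - d)" by (rule sum_mono) (rule cN)
    \<comment> \<open>\<open>insert b T\<close> has at most \<open>Suc r\<close> elements, so
      \<open>T\<close> has at most \<open>r\<close>.\<close>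
    also have "\<dots> \<le> real r * (real (card S) - d)"
      using insert.prems insert.hyps d(2) by (simp add: mult_right_mono)
    finally have "real (card S) - real (card (\<Union>u\<in>T. N u)) \<ge> \<beta> * real (card S)"
      using d(1) by linarith
    also have "real (card S) - real (card (\<Union>u\<in>T. N u)) \<le> real (card (S - (\<Union>u\<in>T. N u)))"
      using diff_card_le_card_Diff[of "\<Union>u\<in>T. N u" S] assms(2) insert.hyps(1)
      by (auto simp: N_def)
    also have "card (S - (\<Union>u\<in>T. N u)) \<le> card (extensions A col T S b \<psi>)"
      by (rule card_mono) (auto simp: finite_extensions assms(2) N_def, auto simp: extensions_def)
    finally show ?thesis by simp
  qed
  have "(\<beta> * real (card S)) ^ card (insert b T)
      = (\<beta> * real (card S)) ^ card T * (\<beta> * real (card S))"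
    using insert.hyps by simp
  also have "\<dots> \<le> real (card (multipartite_homs A col T S)) * (\<beta> * real (card S))"
    using insert assms(5) by (intro mult_right_mono) auto
  also have "\<dots> \<le> (\<Sum>\<psi>\<in>multipartite_homs A col T S. real (card (extensions A col T S b \<psi>)))"
    using sum_mono[OF ext] by simp
  also have "\<dots> = real (card (multipartite_homs A col (insert b T) S))"
    by (subst card_multipartite_homs_insert) (use insert assms in auto)
  finally show ?case .
qed

text \<open>Every vertex of \<open>U\<close> is added as a twin of an equally coloured vertex of
  \<open>T\<close>. Each addition squares the lower bound on the density, whence the exponent
  \<open>2 ^ card U\<close>.\<close>

lemma card_multipartite_homs_blowup:
  assumes "symp A" "finite S" "finite T" "\<beta> > 0"
    and base: "real (card (multipartite_homs A col T S)) \<ge> \<beta> * real (card S) ^ card T"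
    and "finite U" "U \<inter> T = {}" "col ` U \<subseteq> col ` T" "S \<noteq> {}"
  shows "real (card (multipartite_homs A col (U \<union> T) S))
    \<ge> \<beta> ^ (2 ^ card U) * real (card S) ^ card (U \<union> T)"
  using assms(6-8)
proof (induction U rule: finite_induct)
  case empty
  then show ?case using base by simp
next
  case (insert b U)
  define s where "s = real (card S)"
  have s: "s > 0" using assms by (simp add: s_def card_gt_0_iff)
  let ?V = "U \<union> T"
  obtain a where a: "a \<in> T" "col a = col b" using insert.prems by auto
  have "finite ?V" "?V \<noteq> {}" using a insert.hyps assms by auto
  then obtain m where m: "card ?V = Suc m" by (metis card_gt_0_iff gr0_implies_Suc)
  have "(\<beta> ^ (2 ^ card U) * s ^ Suc m)\<^sup>2 \<le> (real (card (multipartite_homs A col ?V S)))\<^sup>2"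
    using insert \<open>\<beta> > 0\<close> s m by (intro power_mono) (auto simp: s_def)
  also have "\<dots> \<le> s ^ m * real (card (multipartite_homs A col (insert b ?V) S))"
    using card_multipartite_homs_twin[of A b ?V a col S] assms insert a m
    unfolding s_def by (simp flip: of_nat_power of_nat_mult of_nat_le_iff)
  \<comment> \<open>Squaring gives \<open>s ^ (2 * m + 2)\<close>; a factor \<open>s ^ m\<close> is
    split off to be cancelled against the one from the twin inequality.\<close>
  finally have "s ^ m * (\<beta> ^ (2 ^ card (insert b U)) * s ^ (Suc (Suc m)))
      \<le> s ^ m * real (card (multipartite_homs A col (insert b ?V) S))"
    using insert.hyps
    by (simp add: power2_eq_square power_add mult_2 algebra_simps)
  then have "\<beta> ^ (2 ^ card (insert b U)) * s ^ (Suc (Suc m))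
      \<le> real (card (multipartite_homs A col (insert b ?V) S))"
    using s by (simp only: mult_le_cancel_left_pos zero_less_power)
  moreover have "card (insert b ?V) = Suc (Suc m)"
    using insert m \<open>finite ?V\<close> by simp
  ultimately show ?case by (simp only: s_def Un_insert_left)
qed

section \<open>Passing to a large subset of high minimum degree\<close>

text \<open>A maximiser \<open>S\<close> of \<open>g\<close> is large because
  \<open>\<epsilon> * (card X)^2 \<le> g X \<le> g S \<le> (card S)^2\<close>. Removing
  \<open>x\<close> from \<open>S\<close> loses at most twice its degree in ordered pairs and lowers
  the penalty by \<open>\<alpha> * (2 * card S - 1)\<close>, so maximality bounds the degree from
  below.\<close>

lemma ex_min_degree_subset:
  fixes \<alpha> \<epsilon> :: real
  assumes "finite X" "symp A" "0 \<le> \<alpha>" "\<alpha> \<le> 1"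
    and dense: "real (card {(x, y). x \<in> X \<and> y \<in> X \<and> A x y}) \<ge> (\<alpha> + \<epsilon>) * (real (card X))\<^sup>2"
  obtains S where "S \<subseteq> X" "(real (card S))\<^sup>2 \<ge> \<epsilon> * (real (card X))\<^sup>2"
    "\<forall>x\<in>S. real (card {y \<in> S. A x y}) \<ge> \<alpha> * real (card S) - 1"
proof -
  define E where "E S = {(x, y). x \<in> S \<and> y \<in> S \<and> A x y}" for S
  define g where "g S = real (card (E S)) - \<alpha> * (real (card S))\<^sup>2" for S
  have finE: "finite (E S)" if "finite S" for S
    by (rule finite_subset[of _ "S \<times> S"]) (use that in \<open>auto simp: E_def\<close>)
  have "finite (g ` Pow X)" "g ` Pow X \<noteq> {}" using assms by auto
  then obtain S where S: "S \<in> Pow X" "g S = Max (g ` Pow X)"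
    by (metis (no_types, lifting) Max_in imageE)
  then have max: "g S' \<le> g S" if "S' \<subseteq> X" for S'
    using that \<open>finite (g ` Pow X)\<close> by simp
  have fS: "finite S" using S assms finite_subset by auto
  have "\<epsilon> * (real (card X))\<^sup>2 \<le> g X" using dense by (simp add: g_def E_def algebra_simps)
  also have "\<dots> \<le> g S" by (rule max) simp
  also have "\<dots> \<le> real (card (E S))" using assms by (simp add: g_def)
  also have "\<dots> \<le> real (card (S \<times> S))"
    using fS by (intro of_nat_mono card_mono) (auto simp: E_def)
  finally have 1: "\<epsilon> * (real (card X))\<^sup>2 \<le> (real (card S))\<^sup>2"
    by (simp add: card_cartesian_product power2_eq_square)
  have 2: "real (card {y \<in> S. A x y}) \<ge> \<alpha> * real (card S) - 1" if x: "x \<in> S" for x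
  proof -
    let ?N = "{y \<in> S. A x y}"
    have "E S = E (S - {x}) \<union> (Pair x ` ?N \<union> (\<lambda>y. (y, x)) ` ?N)"
      using x assms(2) by (auto simp: E_def dest: sympD)
    then have "card (E S) \<le> card (E (S - {x})) + card (Pair x ` ?N \<union> (\<lambda>y. (y, x)) ` ?N)"
      by (metis card_Un_le)
    also have "card (Pair x ` ?N \<union> (\<lambda>y. (y, x)) ` ?N) \<le> card (Pair x ` ?N) + card ((\<lambda>y. (y, x)) ` ?N)"
      by (rule card_Un_le)
    also have "\<dots> \<le> card ?N + card ?N"
      using fS by (intro add_mono card_image_le) auto
    finally have e: "real (card (E S)) \<le> real (card (E (S - {x}))) + 2 * real (card ?N)" by simp
    have c: "real (card (S - {x})) = real (card S) - 1"
      using card_Suc_Diff1[OF fS x] by linarith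
    have "g (S - {x}) \<le> g S" using S by (intro max) auto
    then have "2 * real (card ?N) \<ge> \<alpha> * (2 * real (card S) - 1)"
      using e unfolding g_def c by (simp add: power2_eq_square algebra_simps)
    \<comment> \<open>Halving leaves an error of \<open>\<alpha> / 2\<close>, rounded up to
      1.\<close>
    then show ?thesis using assms by (simp add: algebra_simps)
  qed
  show ?thesis by (rule that[of S]) (use S 1 2 in auto)
qed

section \<open>From many homomorphisms to a Berge copy\<close>

text \<open>Once the other coordinates are fixed, \<open>\<phi> a\<close> has at most
  \<open>c\<close> values. This bounds both kinds of bad maps: collisions with \<open>c = 1\<close>,
  and vertices falling into a foreign hyperedge with \<open>c = k\<close>.\<close>

lemma card_PiE_coordinate_mem_le:
  assumes "finite V" "finite S" "a \<in> V" "\<And>\<psi>. finite (B \<psi>) \<and> card (B \<psi>) \<le> c"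
  shows "card {\<phi> \<in> V \<rightarrow>\<^sub>E S. \<phi> a \<in> B (restrict \<phi> (V - {a}))} \<le> c * card S ^ (card V - 1)"
proof -
  let ?W = "V - {a}"
  let ?D = "SIGMA \<psi> : ?W \<rightarrow>\<^sub>E S. B \<psi>"
  have "{\<phi> \<in> V \<rightarrow>\<^sub>E S. \<phi> a \<in> B (restrict \<phi> ?W)} \<subseteq> (\<lambda>(\<psi>, x). \<psi>(a := x)) ` ?D"
  proof
    fix \<phi> assume \<phi>: "\<phi> \<in> {\<phi> \<in> V \<rightarrow>\<^sub>E S. \<phi> a \<in> B (restrict \<phi> ?W)}"
    then have "\<phi> = (restrict \<phi> ?W)(a := \<phi> a)"
      by (auto simp: fun_eq_iff PiE_def extensional_def)
    moreover have "(restrict \<phi> ?W, \<phi> a) \<in> ?D" using \<phi> by auto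
    ultimately show "\<phi> \<in> (\<lambda>(\<psi>, x). \<psi>(a := x)) ` ?D"
      by (intro image_eqI[of _ _ "(restrict \<phi> ?W, \<phi> a)"]) auto
  qed
  moreover have finD: "finite ?D"
    using assms by (intro finite_SigmaI finite_PiE) auto
  ultimately have "card {\<phi> \<in> V \<rightarrow>\<^sub>E S. \<phi> a \<in> B (restrict \<phi> ?W)} \<le> card ?D"
    by (rule surj_card_le[rotated])
  also have "\<dots> = (\<Sum>\<psi> \<in> ?W \<rightarrow>\<^sub>E S. card (B \<psi>))"
    using assms by (intro card_SigmaI finite_PiE) auto
  also have "\<dots> \<le> (\<Sum>\<psi> \<in> ?W \<rightarrow>\<^sub>E S. c)" using assms by (intro sum_mono) auto
  also have "\<dots> = c * card S ^ (card V - 1)" using assms by (simp add: card_PiE)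
  finally show ?thesis .
qed

lemma simple_graph_edgeE:
  assumes "simple_graph G" "e \<in> edges G"
  obtains u v where "e = {u, v}" "u \<noteq> v" "u \<in> verts G" "v \<in> verts G"
proof -
  have "card e = 2" "e \<subseteq> verts G" using assms by (auto simp: k_graph_def hypergraph_def)
  then show ?thesis using that by (auto simp: card_2_iff)
qed

text \<open>Genericity makes \<open>f\<close> injective: of two distinct edges \<open>e\<close>,
  \<open>e'\<close>, the second has a vertex \<open>a\<close> outside the first, and
  \<open>\<phi> a\<close> lies in \<open>f e'\<close> but not in \<open>f e\<close>. The hyperedges
  \<open>f e\<close> then form the Berge copy.\<close>

lemma Berge_copy_of_generic_map:
  assumes G: "simple_graph G" and H: "hypergraph H"
    and inj: "inj_on \<phi> (verts G)" and im: "\<phi> ` verts G \<subseteq> verts H"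
    and cov: "\<And>e. e \<in> edges G \<Longrightarrow> f e \<in> edges H \<and> \<phi> ` e \<subseteq> f e"
    and gen: "\<And>a e. a \<in> verts G \<Longrightarrow> e \<in> edges G \<Longrightarrow> a \<notin> e \<Longrightarrow> \<phi> a \<notin> f e"
  shows "\<not> Berge_free G H"
proof -
  have fin: "inj_on f (edges G)"
  proof (rule inj_onI, rule ccontr)
    fix e e' assume e: "e \<in> edges G" "e' \<in> edges G" "f e = f e'" "e \<noteq> e'"
    \<comment> \<open>Both edges have two vertices, so inclusion would force equality.\<close>
    then have "\<not> e' \<subseteq> e"
      using G by (elim simple_graph_edgeE[OF G]) auto
    then obtain a where a: "a \<in> e'" "a \<notin> e" by auto
    moreover have "a \<in> verts G" using a e G by (auto simp: k_graph_def hypergraph_def)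
    ultimately show False using gen[of a e] cov[of e'] e by auto
  qed
  let ?H = "(verts H, f ` edges G)"
  have "subhypergraph ?H H"
    using H cov by (auto simp: subhypergraph_def hypergraph_def)
  moreover have "is_Berge G ?H"
    unfolding is_Berge_def
  proof (intro exI conjI allI impI)
    show "bij_betw f (edges G) (edges ?H)" using fin by (simp add: bij_betw_def)
    show "{\<phi> u, \<phi> v} \<subseteq> f {u, v}" if "{u, v} \<in> edges G" for u v using cov[OF that] by auto
  qed (use inj im in auto)
  ultimately show ?thesis by (auto simp: Berge_free_def)
qed

lemma many_homs_imp_not_Berge_free:
  fixes G :: "'a hgraph" and H :: "'b hgraph"
  assumes G: "simple_graph G" and H: "k_graph k H" and "S \<subseteq> verts H"
    and col: "\<And>u v. {u, v} \<in> edges G \<Longrightarrow> col u \<noteq> col v"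
    and many: "card (multipartite_homs (\<lambda>x y. {x, y} \<in> edges (shadow H)) col (verts G) S)
      > (card (verts G) ^ 2 + k * card (verts G) * card (edges G)) * card S ^ (card (verts G) - 1)"
  shows "\<not> Berge_free G H"
proof -
  define V E where "V = verts G" and "E = edges G"
  define M where "M = multipartite_homs (\<lambda>x y. {x, y} \<in> edges (shadow H)) col V S"
  \<comment> \<open>\<open>hh\<close> is also applied to images of edges under maps that are not
    homomorphisms. The default \<open>{}\<close> keeps the size bound \<open>k\<close> for sets that
    no hyperedge covers.\<close>
  define hh where "hh p = (if \<exists>h\<in>edges H. p \<subseteq> h then SOME h. h \<in> edges H \<and> p \<subseteq> h else {})" for p
  have hh: "hh p \<in> edges H \<and> p \<subseteq> hh p" if "\<exists>h\<in>edges H. p \<subseteq> h" for p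
    using someI_ex[of "\<lambda>h. h \<in> edges H \<and> p \<subseteq> h"] that by (auto simp: hh_def)
  have cH: "finite h \<and> card h \<le> k" if "h \<in> edges H" for h
    using H that by (auto simp: k_graph_def hypergraph_def intro: finite_subset)
  have chh: "finite (hh p) \<and> card (hh p) \<le> k" for p
  proof (cases "\<exists>h\<in>edges H. p \<subseteq> h")
    case True then show ?thesis using hh cH by blast
  qed (auto simp: hh_def)
  have fV: "finite V" and EV: "\<And>e. e \<in> E \<Longrightarrow> e \<subseteq> V"
    using G by (auto simp: V_def E_def k_graph_def hypergraph_def)
  have fE: "finite E" using EV fV by (auto intro: finite_subset[of _ "Pow V"])
  have fS: "finite S" using assms(3) H by (auto simp: k_graph_def hypergraph_def intro: finite_subset)
  let ?N = "card S ^ (card V - 1)"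
  \<comment> \<open>\<open>B1\<close> collects the maps identifying two given vertices,
    \<open>B2\<close> those sending a vertex into the hyperedge assigned to an edge that avoids
    it.\<close>
  define B1 where "B1 = (\<lambda>(a, b). {\<phi> \<in> V \<rightarrow>\<^sub>E S. a \<noteq> b \<and> \<phi> a = \<phi> b})"
  define B2 where "B2 = (\<lambda>(a, e). {\<phi> \<in> V \<rightarrow>\<^sub>E S. a \<notin> e \<and> \<phi> a \<in> hh (\<phi> ` e)})"
  have c1: "card (B1 p) \<le> ?N" if "p \<in> V \<times> V" for p
  proof -
    obtain a b where p: "p = (a, b)" "a \<in> V" "b \<in> V" using \<open>p \<in> V \<times> V\<close> by auto
    show ?thesis
    proof (cases "a = b")
      case False
      then have "B1 p = {\<phi> \<in> V \<rightarrow>\<^sub>E S. \<phi> a \<in> {restrict \<phi> (V - {a}) b}}"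
        using p by (auto simp: B1_def)
      then show ?thesis
        using card_PiE_coordinate_mem_le[OF fV fS p(2), of "\<lambda>\<psi>. {\<psi> b}" 1] by simp
    qed (simp add: p B1_def)
  qed
  have c2: "card (B2 p) \<le> k * ?N" if "p \<in> V \<times> E" for p
  proof -
    obtain a e where p: "p = (a, e)" "a \<in> V" "e \<in> E" using \<open>p \<in> V \<times> E\<close> by auto
    show ?thesis
    proof (cases "a \<in> e")
      case False
      \<comment> \<open>As \<open>a\<close> is not in \<open>e\<close>, the hyperedge assigned to
        the image of \<open>e\<close> depends only on the coordinates other than
        \<open>a\<close>.\<close>
      then have "restrict \<phi> (V - {a}) ` e = \<phi> ` e" for \<phi> :: "'a \<Rightarrow> 'b"
        using EV[OF p(3)] by (intro image_cong) auto
      then have "B2 p = {\<phi> \<in> V \<rightarrow>\<^sub>E S. \<phi> a \<in> hh (restrict \<phi> (V - {a}) ` e)}"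
        using p False by (simp add: B2_def)
      then show ?thesis
        using card_PiE_coordinate_mem_le[OF fV fS p(2), of "\<lambda>\<psi>. hh (\<psi> ` e)" k] chh by simp
    qed (simp add: p B2_def)
  qed
  let ?U1 = "\<Union>p\<in>V \<times> V. B1 p" and ?U2 = "\<Union>p\<in>V \<times> E. B2 p"
  have "card ?U1 \<le> (\<Sum>p\<in>V \<times> V. card (B1 p))" by (rule card_UN_le) (simp add: fV)
  also have "\<dots> \<le> (\<Sum>p\<in>V \<times> V. ?N)" by (rule sum_mono) (rule c1)
  also have "\<dots> = card V ^ 2 * ?N" by (simp add: card_cartesian_product power2_eq_square)
  finally have u1: "card ?U1 \<le> card V ^ 2 * ?N" .
  have "card ?U2 \<le> (\<Sum>p\<in>V \<times> E. card (B2 p))" by (rule card_UN_le) (simp add: fV fE)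
  also have "\<dots> \<le> (\<Sum>p\<in>V \<times> E. k * ?N)" by (rule sum_mono) (rule c2)
  also have "\<dots> = k * card V * card E * ?N" by (simp add: card_cartesian_product)
  finally have u2: "card ?U2 \<le> k * card V * card E * ?N" .
  have "card (?U1 \<union> ?U2) \<le> card ?U1 + card ?U2" by (rule card_Un_le)
  also have "\<dots> \<le> (card V ^ 2 + k * card V * card E) * ?N"
    using u1 u2 by (simp add: add_mult_distrib)
  also have "\<dots> < card M" using many by (simp add: M_def V_def E_def)
  finally have "card (?U1 \<union> ?U2) < card M" .
  moreover have "finite (?U1 \<union> ?U2)"
    by (rule finite_subset[of _ "V \<rightarrow>\<^sub>E S"])
      (auto simp: B1_def B2_def intro: finite_PiE fV fS)
  ultimately have "\<not> M \<subseteq> ?U1 \<union> ?U2" using card_mono leD by blast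
  then obtain \<phi> where \<phi>: "\<phi> \<in> M" "\<phi> \<notin> ?U1" "\<phi> \<notin> ?U2" by blast
  have P: "\<phi> \<in> V \<rightarrow>\<^sub>E S" using \<phi>(1) by (simp add: M_def multipartite_homs_def)
  show ?thesis
  proof (rule Berge_copy_of_generic_map[OF G, where \<phi> = \<phi> and f = "\<lambda>e. hh (\<phi> ` e)"])
    show "hypergraph H" using H by (simp add: k_graph_def)
    show "inj_on \<phi> (verts G)"
      using \<phi>(2) P by (force simp: B1_def V_def inj_on_def)
    show "\<phi> ` verts G \<subseteq> verts H" using P assms(3) by (auto simp: V_def)
    show "\<phi> a \<notin> hh (\<phi> ` e)" if "a \<in> verts G" "e \<in> edges G" "a \<notin> e" for a e
      using \<phi>(3) P that by (force simp: B2_def V_def E_def)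
    show "hh (\<phi> ` e) \<in> edges H \<and> \<phi> ` e \<subseteq> hh (\<phi> ` e)" if e: "e \<in> edges G" for e
    proof (rule hh)
      obtain u v where uv: "e = {u, v}" "u \<in> V" "v \<in> V"
        using simple_graph_edgeE[OF G e] by (metis V_def)
      then have "{\<phi> u, \<phi> v} \<in> edges (shadow H)"
        using \<phi>(1) col[of u v] e by (simp add: M_def multipartite_homs_def)
      then obtain x y where "{\<phi> u, \<phi> v} = {x, y}" "\<exists>h\<in>edges H. {x, y} \<subseteq> h"
        by (auto simp: shadow_def)
      then show "\<exists>h\<in>edges H. \<phi> ` e \<subseteq> h" using uv by (metis image_insert image_empty)
    qed
  qed
qed

section \<open>Optimal colourings\<close>

text \<open>An injective numbering of the finitely many vertices is a proper colouring, so the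
  minimum is attained.\<close>

lemma proper_coloring_chromatic_number:
  assumes "simple_graph G"
  obtains col where "proper_coloring G (chromatic_number G) col"
proof -
  have "finite (verts G)" using assms by (simp add: k_graph_def hypergraph_def)
  then obtain f :: "'a \<Rightarrow> nat" and n where f: "f ` verts G = {i. i < n}" "inj_on f (verts G)"
    using finite_imp_inj_to_nat_seg by metis
  have "proper_coloring G n f"
    unfolding proper_coloring_def
  proof (intro conjI allI impI)
    fix u v assume "{u, v} \<in> edges G"
    then have "u \<noteq> v" "u \<in> verts G" "v \<in> verts G"
      using assms by (auto simp: k_graph_def hypergraph_def)
    then show "f u \<noteq> f v" using f by (auto dest: inj_onD)
  qed (use f in auto)
  then have "\<exists>c col. proper_coloring G c col" by blast
  then have "\<exists>col. proper_coloring G (chromatic_number G) col"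
    unfolding chromatic_number_def by (rule LeastI_ex)
  then show ?thesis using that by blast
qed

lemma chromatic_number_le: "proper_coloring G c col \<Longrightarrow> chromatic_number G \<le> c"
  unfolding chromatic_number_def by (rule Least_le) blast

text \<open>If a colour \<open>j\<close> were missing, recolouring the class of the largest colour
  with \<open>j\<close> would save one colour.\<close>

lemma proper_coloring_chromatic_number_surj:
  assumes "simple_graph G" "proper_coloring G (chromatic_number G) col"
  shows "col ` verts G = {..<chromatic_number G}"
proof (rule ccontr)
  assume "col ` verts G \<noteq> {..<chromatic_number G}"
  then obtain j where j: "j < chromatic_number G" "j \<notin> col ` verts G"
    using assms by (auto simp: proper_coloring_def)
  define r where "r = chromatic_number G - 1"
  define col' where "col' v = (if col v = r then j else col v)" for v
  have ends: "u \<in> verts G" "v \<in> verts G" if "{u, v} \<in> edges G" for u v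
    using assms that by (auto simp: k_graph_def hypergraph_def)
  have cl: "col v < Suc r" if "v \<in> verts G" for v
    using assms(2) that j(1) by (auto simp: proper_coloring_def r_def)
  have "proper_coloring G r col'"
    unfolding proper_coloring_def
  proof (intro conjI allI impI subsetI)
    fix x assume "x \<in> col' ` verts G"
    then obtain v where v: "v \<in> verts G" "x = col' v" by auto
    \<comment> \<open>If \<open>j\<close> is itself the largest colour, its class is empty and
      nothing is recoloured.\<close>
    have "j \<noteq> r" if "col v = r" using j(2) v that by auto
    then show "x \<in> {..<r}" using cl[OF v(1)] j(1) v by (auto simp: col'_def r_def)
  next
    fix u v assume uv: "{u, v} \<in> edges G"
    then have "col u \<noteq> col v" using assms(2) by (simp add: proper_coloring_def)
    then show "col' u \<noteq> col' v" using ends[OF uv] j(2) by (auto simp: col'_def)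
  qed
  then show False using chromatic_number_le[of G r col'] j(1) by (simp add: r_def)
qed

section \<open>Shadow edges and their upper bound\<close>

lemma card_ordered_pairs_eq_twice_card_edges:
  assumes "finite X" "symp A" "irreflp A"
  shows "card {(x, y). x \<in> X \<and> y \<in> X \<and> A x y} = 2 * card {{x, y} | x y. x \<in> X \<and> y \<in> X \<and> A x y}"
proof -
  let ?P = "{(x, y). x \<in> X \<and> y \<in> X \<and> A x y}" and ?E = "{{x, y} | x y. x \<in> X \<and> y \<in> X \<and> A x y}"
  let ?g = "\<lambda>(x, y). {x, y}"
  have fP: "finite ?P" by (rule finite_subset[of _ "X \<times> X"]) (use assms in auto)
  have gP: "?g ` ?P = ?E" by auto
  have "card ?P = (\<Sum>e\<in>?g ` ?P. card {p \<in> ?P. ?g p = e})"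
    using sum.image_gen[OF fP, of "\<lambda>_. 1 :: nat" ?g] by simp
  also have "\<dots> = (\<Sum>e\<in>?E. 2)"
    unfolding gP
  proof (rule sum.cong)
    fix e assume "e \<in> ?E"
    then obtain x y where xy: "e = {x, y}" "x \<in> X" "y \<in> X" "A x y" by auto
    then have "A y x" "x \<noteq> y" using assms by (auto dest: sympD irreflpD)
    then have "{p \<in> ?P. ?g p = e} = {(x, y), (y, x)}"
      using xy by (auto simp: doubleton_eq_iff)
    then show "card {p \<in> ?P. ?g p = e} = 2" using \<open>x \<noteq> y\<close> by simp
  qed simp
  finally show ?thesis by simp
qed

lemma symp_shadow: "symp (\<lambda>x y. {x, y} \<in> edges (shadow H))"
  by (auto intro!: sympI simp: insert_commute)

lemma irreflp_shadow: "irreflp (\<lambda>x y. {x, y} \<in> edges (shadow H))"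
  by (auto intro!: irreflpI simp: shadow_def singleton_insert_inj_eq')

lemma card_edges_shadow:
  assumes "hypergraph H"
  shows "card {(x, y). x \<in> verts H \<and> y \<in> verts H \<and> {x, y} \<in> edges (shadow H)}
    = 2 * card (edges (shadow H))"
proof -
  have "{{x, y} | x y. x \<in> verts H \<and> y \<in> verts H \<and> {x, y} \<in> edges (shadow H)} = edges (shadow H)"
    using assms by (fastforce simp: shadow_def hypergraph_def)
  then show ?thesis
    using card_ordered_pairs_eq_twice_card_edges[OF _ symp_shadow irreflp_shadow, of "verts H" H] assms
    by (simp add: hypergraph_def)
qed

text \<open>A denser shadow has a large subset \<open>S\<close> of high minimum degree, hence at
  least \<open>\<delta> * s ^ card V\<close> homomorphisms into it. For large \<open>s\<close> this
  exceeds the number of bad maps, which has one factor \<open>s\<close> fewer.\<close>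

lemma eventually_card_edges_shadow_less:
  fixes G :: "'a hgraph" and \<epsilon> :: real
  assumes G: "simple_graph G" and chi: "chromatic_number G = Suc r" and "r \<ge> 1"
    and \<epsilon>: "0 < \<epsilon>" "\<epsilon> \<le> 1 / real r"
  shows "\<forall>\<^sub>F n in sequentially. \<forall>H :: 'b hgraph.
    k_graph k H \<and> card (verts H) = n \<and> Berge_free G H \<longrightarrow>
    2 * real (card (edges (shadow H))) < (1 - 1 / real r + 2 * \<epsilon>) * (real n)\<^sup>2"
proof -
  define V where "V = verts G"
  have fV: "finite V" using G by (simp add: V_def k_graph_def hypergraph_def)
  obtain col where col: "proper_coloring G (Suc r) col"
    using proper_coloring_chromatic_number[OF G] chi by metis
  have colV: "col ` V = {..<Suc r}"
    using proper_coloring_chromatic_number_surj[OF G] col chi by (simp add: V_def)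
  \<comment> \<open>\<open>T\<close> has one vertex of each colour, so its pattern is the complete
    graph on \<open>r + 1\<close> vertices.\<close>
  obtain T where T: "T \<subseteq> V" "inj_on col T" "col ` T = {..<Suc r}"
    using subset_image_inj[of "{..<Suc r}" col V] colV by auto
  have fT: "finite T" using T fV finite_subset by auto
  have cT: "card T = Suc r" using card_image[OF T(2)] T(3) by simp
  obtain m where m: "card V = Suc m"
    using card_mono[OF fV T(1)] cT by (metis Suc_le_D)
  \<comment> \<open>With degrees at least \<open>\<alpha> * s - 1\<close>, the greedy step leaves
    \<open>r * \<epsilon> * s - r\<close> choices, which is at least \<open>\<beta> * s\<close> once
    \<open>\<epsilon> * s \<ge> 2\<close>.\<close>
  define \<alpha> \<beta> where "\<alpha> = 1 - 1 / real r + \<epsilon>" and "\<beta> = real r * \<epsilon> / 2"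
  define \<delta> where "\<delta> = (\<beta> ^ Suc r) ^ (2 ^ card (V - T))"
  define c where "c = real (card V ^ 2 + k * card V * card (edges G))"
  \<comment> \<open>The first term absorbs the \<open>- 1\<close> in the degree bound; the second
    makes \<open>\<delta> * s\<close> exceed the bad-map constant \<open>c\<close> strictly.\<close>
  define s0 where "s0 = max (2 / \<epsilon>) (c / \<delta> + 1)"
  have \<beta>: "\<beta> > 0" using \<epsilon> \<open>r \<ge> 1\<close> by (simp add: \<beta>_def)
  have \<delta>: "\<delta> > 0" using \<beta> by (simp add: \<delta>_def)
  have "1 / real r \<le> 1" using \<open>r \<ge> 1\<close> by simp
  then have \<alpha>: "0 \<le> \<alpha>" "\<alpha> \<le> 1" using \<epsilon> unfolding \<alpha>_def by linarith+
  have s0: "s0 > 0" using \<epsilon> by (simp add: s0_def less_max_iff_disj)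
  \<comment> \<open>The subset found later has size at least \<open>sqrt \<epsilon> * n\<close>, so
    this makes it at least \<open>s0\<close>.\<close>
  have "\<forall>\<^sub>F n in sequentially. real n \<ge> s0 / sqrt \<epsilon>"
    using filterlim_real_sequentially by (simp add: filterlim_at_top)
  then show ?thesis
  proof (rule eventually_mono, intro allI impI, elim conjE)
    fix n and H :: "'b hgraph"
    assume n: "s0 / sqrt \<epsilon> \<le> real n" and H: "k_graph k H" "card (verts H) = n" "Berge_free G H"
    let ?A = "\<lambda>x y. {x, y} \<in> edges (shadow H)"
    have hH: "hypergraph H" using H by (simp add: k_graph_def)
    have "s0 \<le> sqrt \<epsilon> * real n" using n \<epsilon> by (simp add: field_simps)
    then have "s0\<^sup>2 \<le> (sqrt \<epsilon> * real n)\<^sup>2" using s0 by (intro power_mono) auto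
    then have n2: "s0\<^sup>2 \<le> \<epsilon> * (real n)\<^sup>2" using \<epsilon> by (simp add: power_mult_distrib)
    show "2 * real (card (edges (shadow H))) < (1 - 1 / real r + 2 * \<epsilon>) * (real n)\<^sup>2"
    proof (rule ccontr)
      assume "\<not> ?thesis"
      then have dense: "real (card {(x, y). x \<in> verts H \<and> y \<in> verts H \<and> ?A x y})
          \<ge> (\<alpha> + \<epsilon>) * (real (card (verts H)))\<^sup>2"
        using card_edges_shadow[OF hH] H(2) by (simp add: \<alpha>_def not_less algebra_simps)
      have "finite (verts H)" using hH by (simp add: hypergraph_def)
      obtain S where S: "S \<subseteq> verts H" "(real (card S))\<^sup>2 \<ge> \<epsilon> * (real n)\<^sup>2"
        "\<forall>x\<in>S. real (card {y \<in> S. ?A x y}) \<ge> \<alpha> * real (card S) - 1"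
        by (rule ex_min_degree_subset[OF \<open>finite (verts H)\<close> symp_shadow \<alpha> dense, unfolded H(2)])
      define s where "s = real (card S)"
      have fS: "finite S" using S(1) hH finite_subset by (auto simp: hypergraph_def)
      have "s0\<^sup>2 \<le> s\<^sup>2" using S(2) n2 by (simp add: s_def)
      then have ss0: "s0 \<le> s" by (rule power2_le_imp_le) (simp add: s_def)
      then have s: "s > 0" "2 / \<epsilon> \<le> s" "c / \<delta> < s" using s0 by (auto simp: s0_def)
      then have "S \<noteq> {}" by (auto simp: s_def)
      have "2 \<le> \<epsilon> * s" using s(2) \<epsilon> by (simp add: field_simps)
      then have "real r * 2 \<le> real r * (\<epsilon> * s)" by (rule mult_left_mono) simp
      then have d: "s - real r * (s - (\<alpha> * s - 1)) \<ge> \<beta> * s"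
        using \<open>r \<ge> 1\<close> by (simp add: \<alpha>_def \<beta>_def field_simps)
      have "\<alpha> * s \<le> s" using \<alpha> s by (simp add: mult_left_le_one_le)
      then have "real (card (multipartite_homs ?A col T S)) \<ge> (\<beta> * s) ^ card T"
        using card_multipartite_homs_min_degree[OF symp_shadow fS fT, where d = "\<alpha> * s - 1" and r = r
            and \<beta> = \<beta> and col = col] bspec[OF S(3)] d \<beta> cT
        by (simp add: s_def)
      then have base: "real (card (multipartite_homs ?A col T S)) \<ge> \<beta> ^ Suc r * real (card S) ^ card T"
        by (simp only: power_mult_distrib cT s_def)
      have "real (card (multipartite_homs ?A col (V - T \<union> T) S))
          \<ge> \<delta> * real (card S) ^ card (V - T \<union> T)"
        unfolding \<delta>_def
        by (rule card_multipartite_homs_blowup[OF symp_shadow fS fT _ base])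
          (use \<beta> fV \<open>S \<noteq> {}\<close> T colV in auto)
      moreover have "V - T \<union> T = V" using T(1) by auto
      ultimately have homs: "real (card (multipartite_homs ?A col V S)) \<ge> \<delta> * s ^ Suc m"
        by (simp only: s_def m)
      have "c * s ^ m < \<delta> * s * s ^ m"
        using s \<delta> by (intro mult_strict_right_mono) (auto simp: field_simps)
      then have "real (card (multipartite_homs ?A col V S)) > c * s ^ m"
        using homs by (simp add: mult.assoc)
      then have "card (multipartite_homs ?A col V S)
          > (card V ^ 2 + k * card V * card (edges G)) * card S ^ (card V - 1)"
        unfolding c_def s_def m diff_Suc_1
        by (simp only: of_nat_less_iff flip: of_nat_mult of_nat_power)
      then have "\<not> Berge_free G H"
        using many_homs_imp_not_Berge_free[OF G H(1) S(1), of col] col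
        by (auto simp: V_def proper_coloring_def)
      then show False using H(3) by simp
    qed
  qed
qed

section \<open>The extremal number as an attained maximum\<close>

lemma finite_cover_values:
  "finite {card (edges (shadow H)) | H :: nat hgraph.
     k_graph k H \<and> card (verts H) = n \<and> Berge_free G H}"
proof (rule finite_subset)
  show "{card (edges (shadow H)) | H :: nat hgraph.
     k_graph k H \<and> card (verts H) = n \<and> Berge_free G H} \<subseteq> {..2 ^ n}"
  proof clarsimp
    fix X :: "nat set" and E
    assume H: "k_graph k (X, E)"
    then have "edges (shadow (X, E)) \<subseteq> Pow X" "finite X"
      by (auto simp: shadow_def k_graph_def hypergraph_def)
    then show "card (edges (shadow (X, E))) \<le> 2 ^ card X"
      by (metis card_Pow card_mono finite_Pow_iff)
  qed
qed simp

lemma cover_ex_ge: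
  fixes H :: "nat hgraph"
  assumes "k_graph k H" "card (verts H) = n" "Berge_free G H"
  shows "card (edges (shadow H)) \<le> cover_ex k n G"
  unfolding cover_ex_def by (rule Max_ge[OF finite_cover_values]) (use assms in blast)

text \<open>The edgeless hypergraph is Berge-free because \<open>G\<close> has an edge, so the
  maximum is over a nonempty set.\<close>

lemma cover_ex_attained:
  assumes "edges G \<noteq> {}"
  obtains H :: "nat hgraph" where "k_graph k H" "card (verts H) = n" "Berge_free G H"
    "cover_ex k n G = card (edges (shadow H))"
proof -
  let ?H = "({..<n}, {}) :: nat hgraph"
  have "Berge_free G ?H"
    using assms by (auto simp: Berge_free_def subhypergraph_def is_Berge_def bij_betw_def)
  moreover have "k_graph k ?H" "card (verts ?H) = n" by (auto simp: k_graph_def hypergraph_def)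
  ultimately have "{card (edges (shadow H)) | H :: nat hgraph.
     k_graph k H \<and> card (verts H) = n \<and> Berge_free G H} \<noteq> {}" by blast
  from Max_in[OF finite_cover_values this] show ?thesis
    using that unfolding cover_ex_def[symmetric] by blast
qed

section \<open>The lower-bound construction\<close>

text \<open>The residue classes modulo \<open>r\<close> serve as the balanced classes of the
  partition.\<close>

definition residue_hgraph :: "nat \<Rightarrow> nat \<Rightarrow> nat \<Rightarrow> nat hgraph" where
  "residue_hgraph k r n = ({..<n}, {h. h \<subseteq> {..<n} \<and> card h = k \<and> inj_on (\<lambda>x. x mod r) h})"

lemma k_graph_residue_hgraph: "k_graph k (residue_hgraph k r n)"
  by (auto simp: residue_hgraph_def k_graph_def hypergraph_def)

text \<open>In a Berge copy, the ends of an edge of \<open>G\<close> go to distinct vertices of one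
  hyperedge, hence to different residues. Thus \<open>i v mod r\<close> would colour
  \<open>G\<close> with only \<open>r\<close> colours.\<close>

lemma Berge_free_residue_hgraph:
  assumes "simple_graph G" "r < chromatic_number G" "r > 0"
  shows "Berge_free G (residue_hgraph k r n)"
  unfolding Berge_free_def
proof
  assume "\<exists>H'. subhypergraph H' (residue_hgraph k r n) \<and> is_Berge G H'"
  then obtain H' i f where H': "edges H' \<subseteq> edges (residue_hgraph k r n)"
    and i: "inj_on i (verts G)" and f: "bij_betw f (edges G) (edges H')"
      "\<And>u v. {u, v} \<in> edges G \<Longrightarrow> {i u, i v} \<subseteq> f {u, v}"
    by (auto simp: subhypergraph_def is_Berge_def)
  have "proper_coloring G r (\<lambda>v. i v mod r)"
    unfolding proper_coloring_def
  proof (intro conjI allI impI)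
    fix u v assume uv: "{u, v} \<in> edges G"
    then have "u \<noteq> v" "u \<in> verts G" "v \<in> verts G"
      using assms by (auto simp: k_graph_def hypergraph_def)
    then have "i u \<noteq> i v" using i by (auto dest: inj_onD)
    moreover have "f {u, v} \<in> edges (residue_hgraph k r n)"
      using f(1) uv H' by (auto simp: bij_betw_def)
    then have "inj_on (\<lambda>x. x mod r) (f {u, v})" by (simp add: residue_hgraph_def)
    ultimately show "i u mod r \<noteq> i v mod r"
      using f(2)[OF uv] by (auto dest: inj_onD)
  qed (use assms in auto)
  then show False using chromatic_number_le assms by fastforce
qed

text \<open>The pair is completed to a hyperedge by \<open>k - 2\<close> representatives of other
  classes, taken among the numbers below \<open>r\<close>, which are their own residues. Here
  \<open>k \<le> r\<close> supplies enough classes and \<open>r \<le> n\<close> makes the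
  representatives vertices.\<close>

lemma shadow_residue_hgraph:
  assumes "2 \<le> k" "k \<le> r" "r \<le> n" "u < n" "v < n" "u mod r \<noteq> v mod r"
  shows "{u, v} \<in> edges (shadow (residue_hgraph k r n))"
proof -
  let ?D = "{..<r} - {u mod r, v mod r}"
  have "card ?D = r - 2"
    using assms by (subst card_Diff_subset) auto
  then have "k - 2 \<le> card ?D" using assms by simp
  then obtain D where D: "D \<subseteq> ?D" "card D = k - 2" "finite D"
    by (rule obtain_subset_with_card_n)
  have uv: "u \<notin> D" "v \<notin> D" "u \<noteq> v" using D(1) assms(6) by auto
  let ?h = "insert u (insert v D)"
  have "card ?h = k" using D uv assms by simp
  moreover have "?h \<subseteq> {..<n}" using D(1) assms by auto
  moreover have "inj_on (\<lambda>x. x mod r) D"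
    using D(1) by (intro inj_onI) (metis DiffD1 lessThan_iff mod_less subsetD)
  then have "inj_on (\<lambda>x. x mod r) ?h"
    using D(1) assms(6) by (force simp: subset_iff)
  ultimately have "?h \<in> edges (residue_hgraph k r n)" by (simp add: residue_hgraph_def)
  moreover have "{u, v} \<subseteq> ?h" by simp
  ultimately show ?thesis unfolding shadow_def snd_conv using uv(3) by blast
qed

text \<open>Within a class \<open>v\<close> is determined by \<open>v div r\<close>, which takes
  values from 0 to \<open>n div r\<close>.\<close>

lemma card_residue_class_le: "card {v \<in> {..<n :: nat}. v mod r = c} \<le> n div r + 1"
proof -
  have "inj_on (\<lambda>v. v div r) {v \<in> {..<n}. v mod r = c}"
    by (intro inj_onI) (metis (mono_tags, lifting) div_mult_mod_eq mem_Collect_eq)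
  moreover have "(\<lambda>v. v div r) ` {v \<in> {..<n}. v mod r = c} \<subseteq> {..n div r}"
    by (auto intro: div_le_mono)
  ultimately show ?thesis using card_inj_on_le[of _ _ "{..n div r}"] by fastforce
qed

text \<open>An ordered pair outside the shadow lies within one class, the diagonal included. There
  are at most \<open>n * (n / r + 1)\<close> such pairs, and the remaining pairs count every shadow
  edge twice.\<close>

lemma card_edges_shadow_residue_hgraph:
  assumes "2 \<le> k" "k \<le> r" "r \<le> n"
  shows "(1 - 1 / real r) * (real n)\<^sup>2 - real n \<le> 2 * real (card (edges (shadow (residue_hgraph k r n))))"
proof -
  let ?H = "residue_hgraph k r n"
  let ?N = "{(u, v). u \<in> {..<n} \<and> v \<in> {..<n} \<and> {u, v} \<in> edges (shadow ?H)}"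
  let ?M = "SIGMA u : {..<n}. {v \<in> {..<n}. v mod r = u mod r}"
  have "card ?M = (\<Sum>u<n. card {v \<in> {..<n}. v mod r = u mod r})" by (simp add: card_SigmaI)
  also have "\<dots> \<le> (\<Sum>u<n. n div r + 1)" by (rule sum_mono) (rule card_residue_class_le)
  also have "\<dots> = n * (n div r + 1)" by simp
  finally have "real (card ?M) \<le> real n * real (n div r + 1)"
    by (simp only: of_nat_le_iff flip: of_nat_mult)
  also have "\<dots> \<le> real n * (real n / real r + 1)"
    using of_nat_div_le_of_nat[of n r] by (intro mult_left_mono) auto
  finally have M: "real (card ?M) \<le> real n * (real n / real r + 1)" .
  have N: "finite ?N" by (rule finite_subset[of _ "{..<n} \<times> {..<n}"]) auto
  have "{..<n} \<times> {..<n} \<subseteq> ?M \<union> ?N"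
    using shadow_residue_hgraph[OF assms] by force
  then have "card ({..<n} \<times> {..<n}) \<le> card (?M \<union> ?N)"
    by (rule card_mono[rotated]) (use N in auto)
  also have "\<dots> \<le> card ?M + card ?N" by (rule card_Un_le)
  finally have "real (n * n) \<le> real (card ?M + card ?N)"
    by (simp only: of_nat_le_iff card_cartesian_product card_lessThan)
  moreover have "card ?N = 2 * card (edges (shadow ?H))"
    using card_edges_shadow[of ?H] k_graph_residue_hgraph[of k r n]
    by (simp add: k_graph_def residue_hgraph_def)
  ultimately show ?thesis using M by (simp add: power2_eq_square algebra_simps)
qed

section \<open>Passing to the limit\<close>

lemma real_choose_two: "real (n choose 2) = real n * (real n - 1) / 2"
  by (induction n) (auto simp: numeral_2_eq_2 field_simps)

lemma tendsto_add_inverse_pred: "(\<lambda>n. a + b / (real n - 1)) \<longlonglongrightarrow> a"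
proof -
  have "filterlim (\<lambda>n. real n - 1) at_top sequentially"
    using filterlim_tendsto_add_at_top[OF tendsto_const[of "-1"] filterlim_real_sequentially] by simp
  then have "(\<lambda>n. b / (real n - 1)) \<longlonglongrightarrow> 0"
    by (intro tendsto_divide_0[OF tendsto_const] filterlim_at_top_imp_at_infinity)
  then show ?thesis using tendsto_add[OF tendsto_const[of a]] by fastforce
qed

lemma edges_nonempty_if_chromatic_number_ge_2:
  assumes "chromatic_number G \<ge> 2"
  shows "edges G \<noteq> {}"
proof
  assume "edges G = {}"
  then have "proper_coloring G 1 (\<lambda>_. 0)" by (auto simp: proper_coloring_def)
  then show False using chromatic_number_le assms by fastforce
qed

lemma cover_turan_density_le:
  assumes G: "simple_graph G" and chi: "chromatic_number G = Suc r" and "r \<ge> 1"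
  shows "cover_turan_density k G \<le> ereal (1 - 1 / real r)"
proof (rule ereal_le_epsilon2)
  fix e :: real assume "e > 0"
  \<comment> \<open>The shadow bound exceeds the density by \<open>2 * \<epsilon>\<close>, hence
    \<open>e / 2\<close>; it also requires \<open>\<epsilon> \<le> 1 / r\<close>.\<close>
  define \<epsilon> where "\<epsilon> = min (e / 2) (1 / real r)"
  define c where "c = 1 - 1 / real r + 2 * \<epsilon>"
  have \<epsilon>: "0 < \<epsilon>" "\<epsilon> \<le> 1 / real r" "2 * \<epsilon> \<le> e" using \<open>e > 0\<close> \<open>r \<ge> 1\<close> by (auto simp: \<epsilon>_def)
  have ne: "edges G \<noteq> {}" using chi \<open>r \<ge> 1\<close> by (intro edges_nonempty_if_chromatic_number_ge_2) simp
  \<comment> \<open>Dividing \<open>c * n^2\<close> by \<open>n * (n - 1)\<close> gives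
    \<open>c + c / (n - 1)\<close>.\<close>
  have "\<forall>\<^sub>F n in sequentially. ereal (real (cover_ex k n G) / real (n choose 2))
      \<le> ereal (c + c / (real n - 1))"
    using eventually_card_edges_shadow_less[OF G chi \<open>r \<ge> 1\<close> \<epsilon>(1,2), where 'b = nat and k = k]
      eventually_ge_at_top[of 2]
  proof eventually_elim
    case (elim n)
    obtain H :: "nat hgraph" where H: "k_graph k H" "card (verts H) = n" "Berge_free G H"
      "cover_ex k n G = card (edges (shadow H))" by (rule cover_ex_attained[OF ne])
    have "2 * real (cover_ex k n G) \<le> c * (real n)\<^sup>2"
      using elim(1)[rule_format, of H] H by (simp add: c_def)
    then show ?case using elim(2)
      by (simp add: real_choose_two divide_simps) (simp add: power2_eq_square algebra_simps)
  qed
  then have "cover_turan_density k G \<le> limsup (\<lambda>n. ereal (c + c / (real n - 1)))"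
    unfolding cover_turan_density_def by (rule Limsup_mono)
  also have "\<dots> = ereal c"
    by (intro lim_imp_Limsup tendsto_ereal tendsto_add_inverse_pred) simp
  also have "\<dots> \<le> ereal (1 - 1 / real r) + ereal e" using \<epsilon> by (simp add: c_def)
  finally show "cover_turan_density k G \<le> ereal (1 - 1 / real r) + ereal e" .
qed

lemma cover_turan_density_ge:
  assumes G: "simple_graph G" and "r < chromatic_number G" "2 \<le> k" "k \<le> r"
  shows "ereal (1 - 1 / real r) \<le> cover_turan_density k G"
proof -
  have "\<forall>\<^sub>F n in sequentially. ereal (1 - 1 / real r + (- 1 / real r) / (real n - 1))
      \<le> ereal (real (cover_ex k n G) / real (n choose 2))"
    \<comment> \<open>\<open>n \<ge> 2\<close> makes the binomial coefficient nonzero, and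
      \<open>n \<ge> r\<close> is required by the construction.\<close>
    using eventually_ge_at_top[of "max 2 r"]
  proof eventually_elim
    case (elim n)
    have "card (edges (shadow (residue_hgraph k r n))) \<le> cover_ex k n G"
      using assms by (intro cover_ex_ge k_graph_residue_hgraph Berge_free_residue_hgraph)
        (auto simp: residue_hgraph_def)
    then have "(1 - 1 / real r) * (real n)\<^sup>2 - real n \<le> 2 * real (cover_ex k n G)"
      using card_edges_shadow_residue_hgraph[of k r n] assms elim by simp
    moreover have "1 - 1 / real r + (- 1 / real r) / (real n - 1)
        = ((1 - 1 / real r) * (real n)\<^sup>2 - real n) / (real n * (real n - 1))"
      using elim assms by (simp add: field_simps power2_eq_square)
    ultimately show ?case using elim
      by (simp add: real_choose_two divide_right_mono)
  qed
  then have "limsup (\<lambda>n. ereal (1 - 1 / real r + (- 1 / real r) / (real n - 1)))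
      \<le> cover_turan_density k G"
    unfolding cover_turan_density_def by (rule Limsup_mono)
  moreover have "limsup (\<lambda>n. ereal (1 - 1 / real r + (- 1 / real r) / (real n - 1)))
      = ereal (1 - 1 / real r)"
    by (intro lim_imp_Limsup tendsto_ereal tendsto_add_inverse_pred) simp
  ultimately show ?thesis by simp
qed

theorem theorem2:
  fixes k :: nat and G :: "'a hgraph"
  assumes "k \<ge> 2"
    and "simple_graph G"
    and "chromatic_number G \<ge> k + 1"
  shows "cover_turan_density k G = ereal (1 - 1 / (real (chromatic_number G) - 1))"
proof -
  obtain r where r: "chromatic_number G = Suc r" "k \<le> r"
    using assms(3) by (cases "chromatic_number G") auto
  then show ?thesis
    using cover_turan_density_le[OF assms(2) r(1), of k]
      cover_turan_density_ge[OF assms(2) _ assms(1) r(2)] assms(1)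
    by (intro antisym) auto
qed

end
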